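(* Let $n\ge 2$, let $(c_{ij})$ be the entries of a frieze with $n$ rows and second row $(c_i)_{i\in\mathbb{Z}}$, and let $(C_{ij}(q))$ be the entries of the corresponding $q$-deformed frieze, i.e. the $q$-deformed frieze with $n$ rows and second row $([c_i]_q)_{i\in\mathbb{Z}}$. Then for all integers $i,j$ with $0\le j-i\le n-2$, $$\frac{C_{ij}(q)}{C_{i+1,j}(q)}=\left[\frac{c_{ij}}{c_{i+1,j}}\right]_q=\llbracket c_i,\ldots,c_j\rrbracket_q .$$
   Context: **$q$-integers.** For an integer $a\ge 0$, $[a]_q:=1+q+\cdots+q^{a-1}$ (with $[0]_q=0$), and $[a]_{q^{-1}}$ is obtained by replacing $q$ with $q^{-1}$. **Friezes.** A frieze with $n$ rows is an array of positive integers $c_{ij}$, indexed by integers $i,j$ with $-1\le j-i\le n-2$, where row number $j-i+2$ consists of the entries with fixed $j-i$. The first row consists of $1$'s ($c_{i+1,i}=1$ for all $i$), the last row consists of $1$'s ($c_{i,i+n-2}=1$ for all $i$), and the local unimodular rule $$c_{i,j-1}\,c_{i+1,j}-c_{i+1,j-1}\,c_{ij}=1$$ holds for all $i,j$ with $1\le j-i\le n-2$. The second row is denoted $c_i:=c_{ii}$, and it determines the frieze. **$q$-deformed friezes.** Given a frieze $(c_{ij})$ with $n$ rows and second row $(c_i)_{i\in\mathbb{Z}}$ (that is, an array of positive integers $c_{ij}$, $-1\le j-i\le n-2$, whose first and last rows consist of $1$'s and which satisfies $c_{i,j-1}\,c_{i+1,j}-c_{i+1,j-1}\,c_{ij}=1$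 for all $i,j$ with $1\le j-i\le n-2$, where $c_i:=c_{ii}$), the corresponding $q$-deformed frieze is the array of polynomials $C_{ij}(q)$ in one variable $q$ (say with rational coefficients), with the same index set $-1\le j-i\le n-2$, such that $C_{i+1,i}(q)=1$ and $C_{ii}(q)=[c_i]_q$ for all $i$, and such that $$C_{i,j-1}(q)\,C_{i+1,j}(q)-C_{i+1,j-1}(q)\,C_{ij}(q)=q^{\sum_{k=i}^{j-1}(c_k-1)}$$ for all $i,j$ with $1\le j-i\le n-2$. Starting from the second row, this rule determines every next row inductively. **$q$-rationals.** Every positive rational $\frac{r}{s}$ has a unique regular continued fraction expansion with an even number of coefficients, $$\frac rs=[a_1,\ldots,a_{2m}]=a_1+\cfrac{1}{a_2+\cfrac{1}{\ddots+\cfrac{1}{a_{2m}}}},\qquad a_1\ge 0,\ a_i\ge 1 \text{ for } i\ge 2.$$ The $q$-rational $\left[\frac rs\right]_q$ is the rational function of $q$ given by $$\left[\frac rs\right]_q:=[a_1]_q+\cfrac{q^{a_1}}{[a_2]_{q^{-1}}+\cfrac{q^{-a_2}}{[a_3]_q+\cfrac{q^{a_3}}{[a_4]_{q^{-1}}+\cfrac{q^{-a_4}}{\ddots+\cfrac{q^{-a_{2m-2}}}{[a_{2m-1}]_q+\cfrac{q^{a_{2m-1}}}{[a_{2m}]_{q^{-1}}}}}}}}.$$ **$q$-deformed Hirzebruch-Jung continued fractions.** For positive integers $c_1,\ldots,c_k$, $$\llbracket c_1,\ldots,c_k\rrbracket_q:=[c_1]_q-\cfrac{q^{c_1-1}}{[c_2]_q-\cfrac{q^{c_2-1}}{\ddots-\cfrac{q^{c_{k-2}-1}}{[c_{k-1}]_q-\cfrac{q^{c_{k-1}-1}}{[c_k]_q}}}}.$$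 *)

theory Defs
  imports
    "HOL-Computational_Algebra.Polynomial"
    "HOL-Computational_Algebra.Fraction_Field"
begin

text \<open>
  The index set of both kinds of arrays is the strip $-1 \le j - i \le n - 2$; they are modelled
  as total functions of $i, j$ whose values outside the strip are unconstrained.
\<close>

definition is_frieze :: "nat \<Rightarrow> (int \<Rightarrow> int \<Rightarrow> nat) \<Rightarrow> bool" where
  "is_frieze n c \<longleftrightarrow>
     (\<forall>i j. -1 \<le> j - i \<and> j - i \<le> int n - 2 \<longrightarrow> c i j > 0) \<and>
     (\<forall>i. c (i + 1) i = 1) \<and>
     (\<forall>i. c i (i + int n - 2) = 1) \<and>
     (\<forall>i j. 1 \<le> j - i \<and> j - i \<le> int n - 2 \<longrightarrow>
        int (c i (j - 1)) * int (c (i + 1) j) - int (c (i + 1) (j - 1)) * int (c i j) = 1)"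

text \<open>The parameter \<open>q\<close> is kept arbitrary so that $[a]_{q^{-1}}$ is \<open>q_int (inverse q) a\<close>.\<close>

definition q_int :: "'a::comm_semiring_1 \<Rightarrow> nat \<Rightarrow> 'a" where
  "q_int q a = (\<Sum>k<a. q ^ k)"

text \<open>The truncated subtraction \<open>c k k - 1\<close> is harmless, the entries of a frieze being positive.\<close>

definition is_q_frieze :: "nat \<Rightarrow> (int \<Rightarrow> int \<Rightarrow> nat) \<Rightarrow> (int \<Rightarrow> int \<Rightarrow> rat poly) \<Rightarrow> bool" where
  "is_q_frieze n c C \<longleftrightarrow>
     (\<forall>i. C (i + 1) i = 1) \<and>
     (\<forall>i. C i i = q_int [:0, 1:] (c i i)) \<and>
     (\<forall>i j. 1 \<le> j - i \<and> j - i \<le> int n - 2 \<longrightarrow>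
        C i (j - 1) * C (i + 1) j - C (i + 1) (j - 1) * C i j
          = [:0, 1:] ^ (\<Sum>k = i..j - 1. c k k - 1))"

text \<open>
  In the continued fractions below the value at the empty list is a dummy.
\<close>

fun cfrac :: "nat list \<Rightarrow> rat" where
  "cfrac [] = 0"
| "cfrac [a] = of_nat a"
| "cfrac (a # b # as) = of_nat a + 1 / cfrac (b # as)"

definition is_even_cfrac :: "rat \<Rightarrow> nat list \<Rightarrow> bool" where
  "is_even_cfrac x as \<longleftrightarrow>
     as \<noteq> [] \<and> even (length as) \<and> (\<forall>a\<in>set (tl as). a \<ge> 1) \<and> cfrac as = x"

text \<open>
  The alternation between $q$ and $q^{-1}$ from one level to the next is obtained by passing
  \<open>inverse q\<close> to the recursive call.
\<close>

fun q_cfrac :: "'a::field \<Rightarrow> nat list \<Rightarrow> 'a" where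
  "q_cfrac q [] = 0"
| "q_cfrac q [a] = q_int q a"
| "q_cfrac q (a # b # as) = q_int q a + q ^ a / q_cfrac (inverse q) (b # as)"

fun q_hj_cfrac :: "'a::field \<Rightarrow> nat list \<Rightarrow> 'a" where
  "q_hj_cfrac q [] = 0"
| "q_hj_cfrac q [c] = q_int q c"
| "q_hj_cfrac q (c # d # cs) = q_int q c - q ^ (c - 1) / q_hj_cfrac q (d # cs)"

definition q_var :: "rat poly fract" where
  "q_var = Fract [:0, 1:] 1"

text \<open>Only meaningful for \<open>x > 0\<close>, where the expansion exists and is unique.\<close>

definition q_rational :: "rat \<Rightarrow> rat poly fract" where
  "q_rational x = q_cfrac q_var (THE as. is_even_cfrac x as)"

end

theory Submission
  imports Defs
begin

text \<open>
  Write \<open>R x\<close> for the \<open>q\<close>-rational of \<open>x\<close>. Reading off the even continued fraction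
  expansions of \<open>x + 1\<close> and \<open>x / (x + 1)\<close> gives \<open>R (x + 1) = q * R x + 1\<close> and
  \<open>1 / R (x / (x + 1)) = 1 + 1 / (q * R x)\<close>. Every positive rational is reached from \<open>1\<close> by these two
  moves (Stern-Brocot tree), so \<open>R x\<close> is positive for the ordering of rational functions at infinity,
  and induction on \<open>c\<close> yields \<open>R (c - 1 / y) = [c] - q ^ (c - 1) / R y\<close>. On the other side, the
  unimodular rule linearises to \<open>C i j = [c i] * C (i + 1) j - q ^ (c i - 1) * C (i + 2) j\<close>
  (at \<open>q = 1\<close>: the same for the classical entries), so both sides obey one recursion in \<open>i\<close>.
\<close>

section \<open>Even continued fraction expansions\<close>

text \<open>For \<open>r = []\<close> the next two lemmas hold because \<open>1 / 0 = 0\<close>; this avoids a separate case of length 2.\<close>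

lemma cfrac_Cons_Cons: "cfrac (a # b # r) = of_nat a + 1 / (of_nat b + 1 / cfrac r)"
  by (cases r) auto

lemma q_cfrac_Cons_Cons:
  "q_cfrac q (a # b # r) = q_int q a + q ^ a / (q_int (inverse q) b + inverse q ^ b / q_cfrac q r)"
  by (cases r) auto

declare cfrac.simps(3) [simp del] q_cfrac.simps(3) [simp del]

lemma q_int_0 [simp]: "q_int q 0 = 0"
  by (simp add: q_int_def)

lemma q_int_Suc: "q_int q (Suc a) = q_int q a + q ^ a"
  by (simp add: q_int_def)

lemma q_int_Suc_shift: "q_int q (Suc a) = 1 + q * q_int q a"
  by (simp add: q_int_def sum.lessThan_Suc_shift sum_distrib_left del: sum.lessThan_Suc)

lemma even_list_induct [consumes 1, case_names Nil Cons_Cons]: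
  assumes "even (length xs)"
    and "P []"
    and "\<And>a b r. even (length r) \<Longrightarrow> P r \<Longrightarrow> P (a # b # r)"
  shows "P xs"
  using assms(1)
proof (induction xs rule: induct_list012)
  case (3 a b r)
  then show ?case using assms(3) by simp
qed (use assms(2) in auto)

text \<open>A nonempty \<open>r\<close> has value above 1, while \<open>r = []\<close> gives
  \<open>1 / 0 = 0\<close>, hence the non-strict lower bound. Even length makes the upper bound
  strict: \<open>[1]\<close> would reach 1.\<close>

lemma inverse_cfrac_even_bounds:
  assumes "even (length r)" "\<forall>a\<in>set r. a \<ge> 1"
  shows "0 \<le> 1 / cfrac r \<and> 1 / cfrac r < 1"
  using assms
proof (induction r rule: even_list_induct)
  case (Cons_Cons a b r)
  then have r: "0 \<le> 1 / cfrac r" and ab: "(1::rat) \<le> of_nat a" "(1::rat) \<le> of_nat b"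
    by auto
  then have "0 < 1 / (of_nat b + 1 / cfrac r)"
    by (intro divide_pos_pos add_pos_nonneg) auto
  then have "1 < cfrac (a # b # r)"
    using ab by (simp add: cfrac_Cons_Cons del: zero_less_divide_1_iff)
  then show ?case by simp
qed simp

lemma cfrac_Cons_Cons_remainder:
  assumes "even (length r)" "\<forall>a\<in>set (b # r). a \<ge> 1"
  defines "t \<equiv> 1 / (of_nat b + 1 / cfrac r)"
  shows "0 < t" "t \<le> 1"
proof -
  have "1 \<le> of_nat b + 1 / cfrac r"
    using inverse_cfrac_even_bounds[of r] assms by (simp add: add_increasing2)
  then show "0 < t" "t \<le> 1" by (auto simp: t_def)
qed

lemma cfrac_Cons_Cons_eqD:
  assumes "even (length r)" "\<forall>a\<in>set (b # r). a \<ge> 1"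
    and "even (length r')" "\<forall>a\<in>set (b' # r'). a \<ge> 1"
    and eq: "cfrac (a # b # r) = cfrac (a' # b' # r')"
  shows "a = a' \<and> b = b' \<and> cfrac r = cfrac r'"
proof -
  \<comment> \<open>The remainder lies in (0, 1] and equals 1 for \<open>b = 1\<close>,
    \<open>r = []\<close>, so the ceiling rather than the floor recovers \<open>a\<close>.\<close>
  have "\<lceil>of_nat a + s\<rceil> = int a + 1" if "0 < s" "s \<le> 1" for a and s :: rat
    using that by (intro ceiling_unique) auto
  from this[OF cfrac_Cons_Cons_remainder[OF assms(1,2)], of a]
    this[OF cfrac_Cons_Cons_remainder[OF assms(3,4)], of a']
  have "int a + 1 = int a' + 1"
    using eq unfolding cfrac_Cons_Cons by simp
  then have a: "a = a'" by simp
  then have b: "of_nat b + 1 / cfrac r = of_nat b' + 1 / cfrac r'"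
    using eq unfolding cfrac_Cons_Cons by simp
  \<comment> \<open>One level down the remainder lies in [0, 1), with 0 for an empty tail, so here
    the floor works.\<close>
  have "\<lfloor>of_nat b + s\<rfloor> = int b" if "0 \<le> s" "s < 1" for b and s :: rat
    using that by (intro floor_unique) auto
  from this[of "1 / cfrac r" b] this[of "1 / cfrac r'" b'] have "int b = int b'"
    using b inverse_cfrac_even_bounds[of r] inverse_cfrac_even_bounds[of r'] assms(1-4) by simp
  with a b show ?thesis by simp
qed

lemma cfrac_even_inj:
  assumes "even (length xs)" "\<forall>a\<in>set (tl xs). a \<ge> 1"
    and "even (length ys)" "\<forall>a\<in>set (tl ys). a \<ge> 1"
    and "xs = [] \<longleftrightarrow> ys = []"
    and "cfrac xs = cfrac ys"
  shows "xs = ys"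
  using assms
proof (induction xs arbitrary: ys rule: even_list_induct)
  case (Cons_Cons a b r)
  from Cons_Cons.prems obtain a' b' r' where ys: "ys = a' # b' # r'" "even (length r')"
    by (cases ys; cases "tl ys") auto
  with Cons_Cons.prems Cons_Cons.hyps have eq: "a = a' \<and> b = b' \<and> cfrac r = cfrac r'"
    by (intro cfrac_Cons_Cons_eqD) auto
  have ge: "\<forall>a\<in>set r. a \<ge> 1" "\<forall>a\<in>set r'. a \<ge> 1"
    using Cons_Cons.prems ys by auto
  \<comment> \<open>The empty tail has the default value 0 and no other admissible tail does, so
    equal values force both expansions to end together.\<close>
  have "cfrac s \<noteq> 0" if "s \<noteq> []" "even (length s)" "\<forall>a\<in>set s. a \<ge> 1" for s
  proof -
    from that obtain a b t where "s = a # b # t" "even (length t)"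
      by (cases s; cases "tl s") auto
    with that cfrac_Cons_Cons_remainder[of t b] show ?thesis
      by (simp add: cfrac_Cons_Cons add_nonneg_eq_0_iff less_imp_le del: zero_less_divide_1_iff)
  qed
  with eq ge ys Cons_Cons.hyps have "r = [] \<longleftrightarrow> r' = []"
    by (metis cfrac.simps(1))
  moreover have "\<forall>a\<in>set (tl r). a \<ge> 1" "\<forall>a\<in>set (tl r'). a \<ge> 1"
    using ge by (cases r; cases r'; simp)+
  ultimately have "r = r'"
    using Cons_Cons.IH[of r'] eq ys by blast
  with eq ys show ?case by simp
qed simp

lemma is_even_cfrac_unique: "is_even_cfrac x xs \<Longrightarrow> is_even_cfrac x ys \<Longrightarrow> xs = ys"
  unfolding is_even_cfrac_def by (intro cfrac_even_inj) auto

lemma is_even_cfracE: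
  assumes "is_even_cfrac x xs"
  obtains a b r where "xs = a # b # r" "even (length r)" "b \<ge> 1" "\<forall>a\<in>set r. a \<ge> 1"
  using assms unfolding is_even_cfrac_def by (cases xs; cases "tl xs") auto

lemma q_rational_eq: "is_even_cfrac x xs \<Longrightarrow> q_rational x = q_cfrac q_var xs"
  unfolding q_rational_def by (metis is_even_cfrac_unique the_equality)

lemma is_even_cfrac_1: "is_even_cfrac 1 [0, 1]"
  by (simp add: is_even_cfrac_def cfrac_Cons_Cons)

lemma is_even_cfrac_add_1: "is_even_cfrac x (a # xs) \<Longrightarrow> is_even_cfrac (x + 1) (Suc a # xs)"
  by (cases xs) (auto simp: is_even_cfrac_def cfrac_Cons_Cons)

text \<open>The reciprocal of \<open>x / (x + 1)\<close> is \<open>1 + 1 / x\<close>, and with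
  leading coefficient 0 the expansion of \<open>1 / x\<close> starts with \<open>b\<close>.\<close>

lemma is_even_cfrac_mediant_0:
  assumes "is_even_cfrac x (0 # b # r)" "x > 0"
  shows "is_even_cfrac (x / (x + 1)) (0 # Suc b # r)"
proof -
  let ?d = "of_nat b + 1 / cfrac r"
  have x: "x = 1 / ?d"
    using assms unfolding is_even_cfrac_def cfrac_Cons_Cons by simp
  with assms(2) have "?d > 0" by simp
  then have "x / (x + 1) = 1 / (?d + 1)"
    unfolding x by (simp add: divide_simps)
  then show ?thesis
    using assms unfolding is_even_cfrac_def cfrac_Cons_Cons by (simp add: add_ac)
qed

text \<open>Writing \<open>x / (x + 1)\<close> as \<open>0 + 1 / (1 + 1 / x)\<close> prepends two
  coefficients, which keeps the length even. The old leading coefficient becomes an inner one and so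
  must be nonzero.\<close>

lemma is_even_cfrac_mediant_Suc:
  assumes "is_even_cfrac x (Suc a # b # r)" "x > 0"
  shows "is_even_cfrac (x / (x + 1)) (0 # Suc 0 # Suc a # b # r)"
proof -
  have "x / (x + 1) = 1 / (1 + 1 / x)"
    using assms(2) by (simp add: field_simps)
  with assms(1) show ?thesis
    by (auto simp: is_even_cfrac_def cfrac_Cons_Cons[of 0 "Suc 0"])
qed

section \<open>The Stern-Brocot recursion for q-rationals\<close>

text \<open>This is the subtractive Euclidean algorithm on a fraction \<open>m / n\<close>, not
  necessarily reduced: the smaller term is subtracted from the larger, \<open>m + n\<close> drops,
  and \<open>m = n\<close> ends it.\<close>

lemma pos_rat_induct [consumes 1, case_names one add mediant]:
  fixes x :: rat
  assumes "x > 0"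
    and one: "P 1"
    and add: "\<And>x. x > 0 \<Longrightarrow> P x \<Longrightarrow> P (x + 1)"
    and mediant: "\<And>x. x > 0 \<Longrightarrow> P x \<Longrightarrow> P (x / (x + 1))"
  shows "P x"
proof -
  have "P (of_nat m / of_nat n)" if "m > 0" "n > 0" for m n :: nat
    using that
  proof (induction "m + n" arbitrary: m n rule: less_induct)
    case less
    consider "m = n" | "m > n" | "m < n" by linarith
    then show ?case
    proof cases
      case 1
      with less.prems one show ?thesis by simp
    next
      case 2
      have "P (of_nat (m - n) / of_nat n + 1)"
        using 2 less by (intro add less.hyps) auto
      also have "of_nat (m - n) / of_nat n + 1 = (of_nat m / of_nat n :: rat)"
        using 2 less.prems by (simp add: of_nat_diff field_simps)
      finally show ?thesis .
    next
      case 3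
      define y :: rat where "y = of_nat m / of_nat (n - m)"
      have "P (y / (y + 1))"
        unfolding y_def using 3 less by (intro mediant less.hyps) auto
      also have "y + 1 = of_nat n / of_nat (n - m)"
        using 3 by (simp add: y_def of_nat_diff field_simps)
      then have "y / (y + 1) = of_nat m / of_nat n"
        using 3 less.prems by (simp add: y_def)
      finally show ?thesis .
    qed
  qed
  moreover obtain a b where "x = Rat.Fract a b" "b > 0"
    by (cases x) auto
  then have "x = of_nat (nat a) / of_nat (nat b)" "nat a > 0" "nat b > 0"
    using \<open>x > 0\<close> by (auto simp: Fract_of_int_quotient zero_less_divide_iff)
  ultimately show ?thesis by metis
qed

lemma is_even_cfrac_exists:
  assumes "x > 0"
  shows "\<exists>xs. is_even_cfrac x xs"
  using assms
proof (induction x rule: pos_rat_induct)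
  case one
  show ?case using is_even_cfrac_1 by blast
next
  case (add x)
  then show ?case by (metis is_even_cfracE is_even_cfrac_add_1)
next
  case (mediant x)
  then show ?case
    by (metis is_even_cfracE is_even_cfrac_mediant_0 is_even_cfrac_mediant_Suc not0_implies_Suc)
qed

lemma q_rational_1: "q_rational 1 = 1"
  by (simp add: q_rational_eq[OF is_even_cfrac_1] q_cfrac_Cons_Cons q_int_def)

lemma q_rational_add_1:
  assumes "x > 0"
  shows "q_rational (x + 1) = q_var * q_rational x + 1"
proof -
  obtain xs where "is_even_cfrac x xs"
    using is_even_cfrac_exists[OF assms] ..
  moreover from this obtain a b r where "xs = a # b # r"
    by (rule is_even_cfracE)
  ultimately show ?thesis
    using is_even_cfrac_add_1[of x a "b # r"]
    by (simp add: q_rational_eq q_cfrac_Cons_Cons q_int_Suc_shift algebra_simps)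
qed

text \<open>Reciprocals make the move affine. Raising \<open>b\<close> by one uses the shift rule of
  \<open>q_int\<close> at \<open>inverse q_var\<close>; prepending 0, 1 gives the right-hand side
  directly.\<close>

lemma inverse_q_rational_mediant:
  assumes "x > 0"
  shows "inverse (q_rational (x / (x + 1))) = 1 + inverse q_var * inverse (q_rational x)"
proof -
  obtain xs where xs: "is_even_cfrac x xs"
    using is_even_cfrac_exists[OF assms] ..
  then obtain a b r where abr: "xs = a # b # r"
    by (rule is_even_cfracE)
  show ?thesis
  proof (cases a)
    case 0
    with xs abr assms have "is_even_cfrac (x / (x + 1)) (0 # Suc b # r)"
      by (auto intro: is_even_cfrac_mediant_0)
    with xs abr 0 show ?thesis
      by (simp add: q_rational_eq q_cfrac_Cons_Cons q_int_Suc_shift algebra_simps)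
  next
    case (Suc a')
    with xs abr assms have "is_even_cfrac (x / (x + 1)) (0 # Suc 0 # xs)"
      by (auto intro: is_even_cfrac_mediant_Suc)
    with xs show ?thesis
      by (simp add: q_rational_eq q_cfrac_Cons_Cons q_int_def divide_inverse)
  qed
qed

lemma q_var_pos: "q_var > 0"
  by (simp add: q_var_def zero_less_Fract_iff less_poly_def pos_poly_def)

text \<open>Both moves preserve positivity. This is what guarantees that the denominators in the
  later identities, and finally the entries \<open>C i j\<close>, do not vanish.\<close>

lemma q_rational_pos:
  assumes "x > 0"
  shows "q_rational x > 0"
  using assms
proof (induction x rule: pos_rat_induct)
  case one
  show ?case by (simp add: q_rational_1)
next
  case (add x)
  then show ?case by (simp add: q_rational_add_1 q_var_pos add_pos_pos)
next
  case (mediant x)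
  then have "0 < inverse (q_rational (x / (x + 1)))"
    using q_var_pos by (simp add: inverse_q_rational_mediant add_pos_pos)
  then show ?case by simp
qed

section \<open>Integer shifts and the Hirzebruch-Jung step\<close>

lemma q_rational_add_of_nat:
  assumes "x > 0"
  shows "q_rational (x + of_nat a) = q_int q_var a + q_var ^ a * q_rational x"
proof (induction a)
  case (Suc a)
  have "q_rational (x + of_nat (Suc a)) = q_rational ((x + of_nat a) + 1)"
    by (simp add: add_ac)
  also have "\<dots> = q_var * q_rational (x + of_nat a) + 1"
    using assms by (intro q_rational_add_1) (simp add: add_pos_nonneg)
  finally show ?case
    by (simp add: Suc.IH q_int_Suc_shift algebra_simps)
qed simp

lemma q_rational_of_nat:
  assumes "a > 0"
  shows "q_rational (of_nat a) = q_int q_var a"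
proof -
  from assms obtain b where "a = Suc b" by (cases a) auto
  with q_rational_add_of_nat[of 1 b] show ?thesis
    by (simp add: q_rational_1 q_int_Suc add_ac)
qed

text \<open>With \<open>y = z + 1\<close> the argument is \<open>z / (z + 1)\<close>, so both
  Stern-Brocot moves are applied to the same \<open>z\<close> and compared.\<close>

lemma q_rational_1_minus_inverse:
  assumes "y > 1"
  shows "q_rational (1 - 1 / y) = 1 - 1 / q_rational y"
proof -
  define z where "z = y - 1"
  have z: "z > 0" "y = z + 1" using assms by (simp_all add: z_def)
  have nz: "q_rational z > 0" "q_var * q_rational z + 1 > 0"
    using z q_var_pos by (auto intro!: q_rational_pos add_pos_pos mult_pos_pos)
  have "1 - 1 / y = z / (z + 1)" using z by (simp add: field_simps)
  then have "q_rational (1 - 1 / y) = inverse (1 + inverse q_var * inverse (q_rational z))"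
    using inverse_q_rational_mediant[OF z(1)] by (metis inverse_inverse_eq)
  also have "\<dots> = 1 - 1 / (q_var * q_rational z + 1)"
    using nz q_var_pos by (simp add: field_simps)
  finally show ?thesis using z by (simp add: q_rational_add_1)
qed

lemma q_rational_minus_inverse:
  assumes "y > 0" "of_nat c - 1 / y > 0"
  shows "q_rational (of_nat c - 1 / y) = q_int q_var c - q_var ^ (c - 1) / q_rational y"
  using assms
proof (induction c arbitrary: y)
  case 0
  then show ?case by (simp add: divide_less_0_iff)
next
  case (Suc c)
  consider "y > 1" | "y = 1" | "y < 1" by linarith
  then show ?case
  proof cases
    case 1
    have "of_nat (Suc c) - 1 / y = (1 - 1 / y) + of_nat c" by simp
    moreover have "1 - 1 / y > 0" using 1 by simp
    ultimately have "q_rational (of_nat (Suc c) - 1 / y)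
        = q_int q_var c + q_var ^ c * q_rational (1 - 1 / y)"
      by (simp only: q_rational_add_of_nat)
    then show ?thesis
      using 1 by (simp add: q_rational_1_minus_inverse q_int_Suc algebra_simps)
  next
    case 2
    with Suc.prems show ?thesis
      by (simp add: q_rational_of_nat q_rational_1 q_int_Suc)
  next
    case 3
    \<comment> \<open>Chosen so that \<open>1 / z = 1 / y - 1\<close>: then \<open>y\<close> is the
      mediant move of \<open>z\<close>, and \<open>c\<close> drops by one.\<close>
    define z where "z = y / (1 - y)"
    have z: "z > 0" using 3 Suc.prems by (simp add: z_def)
    have y: "y = z / (z + 1)" using 3 by (simp add: z_def field_simps)
    have eq: "of_nat (Suc c) - 1 / y = of_nat c - 1 / z"
      using z by (simp add: y field_simps)
    with Suc.prems have pos: "of_nat c - 1 / z > 0" by simp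
    \<comment> \<open>This keeps the truncated exponent \<open>c - 1\<close> honest.\<close>
    with z have "c > 0" by (cases c) (auto simp: divide_less_0_iff)
    then have "q_var ^ c * inverse q_var = q_var ^ (c - 1)"
      using q_var_pos by (cases c) auto
    moreover have "inverse (q_rational y) = 1 + inverse q_var * inverse (q_rational z)"
      unfolding y by (rule inverse_q_rational_mediant[OF z])
    ultimately have "q_int q_var (Suc c) - q_var ^ c / q_rational y
        = q_int q_var c - q_var ^ (c - 1) / q_rational z"
      by (simp add: q_int_Suc divide_inverse distrib_left flip: mult.assoc)
    then show ?thesis
      using Suc.IH[OF z pos] by (simp only: eq diff_Suc_1)
  qed
qed

section \<open>Linearisation of the unimodular rule\<close>

text \<open>The weights \<open>w\<close> cover both arrays: constantly 1 for the frieze, powers of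
  \<open>q\<close> for its deformation. The rule at row \<open>i\<close> has \<open>w i\<close>
  times the right-hand side of the rule at row \<open>i + 1\<close>; comparing them and cancelling
  \<open>C (i + 1) j\<close> advances \<open>j\<close>.\<close>

lemma unimodular_recurrence:
  fixes C :: "int \<Rightarrow> int \<Rightarrow> 'a::idom" and w :: "int \<Rightarrow> 'a"
  assumes first: "\<And>i. C (i + 1) i = 1"
    and rule: "\<And>i j. 1 \<le> j - i \<Longrightarrow> j - i \<le> N \<Longrightarrow>
      C i (j - 1) * C (i + 1) j - C (i + 1) (j - 1) * C i j = (\<Prod>k = i..j - 1. w k)"
    and "i + 1 \<le> j" "j - i \<le> N"
    and nz: "\<And>k. i + 1 \<le> k \<Longrightarrow> k < j \<Longrightarrow> C (i + 1) k \<noteq> 0"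
  shows "C i j = C i i * C (i + 1) j - w i * C (i + 2) j"
  using assms(3-)
proof (induction j rule: int_ge_induct)
  case base
  then show ?case
    using rule[of "i + 1" i] first[of i] first[of "i + 1"] by (simp add: algebra_simps)
next
  case (step j)
  have IH: "C i j = C i i * C (i + 1) j - w i * C (i + 2) j"
    using step by auto
  have "{i..j} = insert i {i + 1..j}" using step.hyps by auto
  then have split: "(\<Prod>k = i..j. w k) = w i * (\<Prod>k = i + 1..j. w k)"
    by simp
  have 1: "C i j * C (i + 1) (j + 1) - C (i + 1) j * C i (j + 1) = (\<Prod>k = i..j. w k)"
    using rule[of "j + 1" i] step by simp
  have 2: "C (i + 1) j * C (i + 2) (j + 1) - C (i + 2) j * C (i + 1) (j + 1)
      = (\<Prod>k = i + 1..j. w k)"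
    using rule[of "j + 1" "i + 1"] step by (simp add: add.assoc)
  have "C (i + 1) j * C i (j + 1)
      = C (i + 1) j * (C i i * C (i + 1) (j + 1) - w i * C (i + 2) (j + 1))"
    using 1 unfolding split 2[symmetric] IH by (simp add: algebra_simps)
  moreover have "C (i + 1) j \<noteq> 0" using step by auto
  ultimately show ?case by simp
qed

lemma frieze_recurrence:
  assumes "is_frieze n c" "i + 1 \<le> j" "j - i \<le> int n - 2"
  shows "int (c i j) = int (c i i) * int (c (i + 1) j) - int (c (i + 2) j)"
proof -
  have "c (i + 1) k \<noteq> 0" if "i + 1 \<le> k" "k < j" for k
  proof -
    have "-1 \<le> k - (i + 1)" "k - (i + 1) \<le> int n - 2"
      using assms(3) that by auto
    with assms(1) have "c (i + 1) k > 0"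
      unfolding is_frieze_def by blast
    then show ?thesis by simp
  qed
  then show ?thesis
    using unimodular_recurrence[of "\<lambda>i j. int (c i j)" "int n - 2" "\<lambda>_. 1" i j] assms
    by (simp add: is_frieze_def)
qed

lemma q_frieze_recurrence:
  assumes "is_q_frieze n c C" "i + 1 \<le> j" "j - i \<le> int n - 2"
    and "\<And>k. i + 1 \<le> k \<Longrightarrow> k < j \<Longrightarrow> C (i + 1) k \<noteq> 0"
  shows "C i j = q_int [:0, 1:] (c i i) * C (i + 1) j - [:0, 1:] ^ (c i i - 1) * C (i + 2) j"
  using unimodular_recurrence[of C "int n - 2" "\<lambda>k. [:0, 1:] ^ (c k k - 1)" i j] assms
  by (simp add: is_q_frieze_def power_sum)

section \<open>Passage to the fraction field and induction on \<open>j - i\<close>\<close>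

lemma Fract_power: "Fract a b ^ k = Fract (a ^ k) (b ^ k)"
  by (induction k) (simp_all add: One_fract_def)

lemma Fract_q_int: "Fract (q_int [:0, 1:] a) 1 = q_int q_var a"
proof (induction a)
  case 0
  show ?case by (simp add: Zero_fract_def)
next
  case (Suc a)
  have "Fract (q_int [:0, 1:] (Suc a)) 1 = Fract (q_int [:0, 1:] a) 1 + q_var ^ a"
    by (simp add: q_int_Suc q_var_def Fract_power)
  with Suc show ?case by (simp add: q_int_Suc)
qed

text \<open>Nonvanishing is proved in the same strong induction: the recurrence cancels shorter
  entries, and their being nonzero comes from positivity of the q-rationals they represent.\<close>

lemma q_frieze_row:
  fixes n :: nat and c :: "int \<Rightarrow> int \<Rightarrow> nat" and C :: "int \<Rightarrow> int \<Rightarrow> rat poly"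
  assumes c: "is_frieze n c" and C: "is_q_frieze n c C"
    and "int d \<le> int n - 2"
  defines "x \<equiv> \<lambda>i j. of_nat (c i j) / of_nat (c (i + 1) j) :: rat"
  shows "C i (i + int d) \<noteq> 0 \<and>
    Fract (C i (i + int d)) (C (i + 1) (i + int d)) = q_rational (x i (i + int d)) \<and>
    q_rational (x i (i + int d)) = q_hj_cfrac q_var (map (\<lambda>k. c k k) [i..i + int d])"
  using assms(3)
proof (induction d arbitrary: i rule: less_induct)
  case (less d)
  let ?j = "i + int d"
  have pos: "c i j > 0" if "-1 \<le> j - i" "j - i \<le> int n - 2" for i j
    using c that unfolding is_frieze_def by blast
  have nz: "C k l \<noteq> 0" if "k \<le> l + 1" "l - k < int d" for k l
  proof (cases "k = l + 1")
    case True
    then show ?thesis using C by (simp add: is_q_frieze_def)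
  next
    case False
    with that less.prems less.IH[of "nat (l - k)" k] show ?thesis by simp
  qed
  have x_pos: "x i ?j > 0"
    unfolding x_def using less.prems by (intro divide_pos_pos) (simp_all add: pos)
  have main: "Fract (C i ?j) (C (i + 1) ?j) = q_rational (x i ?j) \<and>
    q_rational (x i ?j) = q_hj_cfrac q_var (map (\<lambda>k. c k k) [i..?j])"
  proof (cases d)
    case 0
    have "c (i + 1) i = 1" "C (i + 1) i = 1" "C i i = q_int [:0, 1:] (c i i)"
      using c C by (auto simp: is_frieze_def is_q_frieze_def)
    moreover have "c i i > 0" using pos[of i i] 0 less.prems by simp
    ultimately show ?thesis
      by (simp add: 0 x_def q_rational_of_nat Fract_q_int)
  next
    case (Suc e)
    have j: "?j = (i + 1) + int e" using Suc by simp
    let ?y = "x (i + 1) ?j"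
    have y_eq: "?y = of_nat (c (i + 1) ?j) / of_nat (c (i + 2) ?j)"
      by (simp add: x_def add.assoc)
    have y_pos: "?y > 0"
      unfolding y_eq using less.prems Suc by (intro divide_pos_pos) (simp_all add: pos)
    have c_rec: "int (c i ?j) = int (c i i) * int (c (i + 1) ?j) - int (c (i + 2) ?j)"
      using frieze_recurrence[OF c, of i ?j] less.prems Suc by simp
    have "of_nat (c i ?j) = (of_int (int (c i ?j)) :: rat)" by simp
    also have "\<dots> = of_nat (c i i) * of_nat (c (i + 1) ?j) - of_nat (c (i + 2) ?j)"
      unfolding c_rec by simp
    finally have c_rec': "rat_of_nat (c i ?j) = \<dots>" .
    have "c (i + 1) ?j > 0" using less.prems Suc by (intro pos) auto
    then have x_rec: "x i ?j = of_nat (c i i) - 1 / ?y"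
      unfolding y_eq unfolding x_def c_rec' by (simp add: diff_divide_distrib)
    \<comment> \<open>The positivity demanded of \<open>c i i - 1 / ?y\<close> is that of
      \<open>x i ?j\<close>, a quotient of frieze entries.\<close>
    have R: "q_rational (x i ?j)
        = q_int q_var (c i i) - q_var ^ (c i i - 1) / q_rational ?y"
      unfolding x_rec using y_pos x_pos x_rec by (intro q_rational_minus_inverse) auto
    have IH: "Fract (C (i + 1) ?j) (C (i + 2) ?j) = q_rational ?y"
      "q_rational ?y = q_hj_cfrac q_var (map (\<lambda>k. c k k) [i + 1..?j])"
      using less.IH[of e "i + 1"] less.prems Suc unfolding j by (simp_all add: add.assoc)
    have nz1: "C (i + 1) ?j \<noteq> 0" using nz[of "i + 1" ?j] by simp
    have nz2: "C (i + 2) ?j \<noteq> 0" using nz[of "i + 2" ?j] Suc by simp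
    have "C i ?j = q_int [:0, 1:] (c i i) * C (i + 1) ?j - [:0, 1:] ^ (c i i - 1) * C (i + 2) ?j"
      using Suc less.prems by (intro q_frieze_recurrence[OF C] nz) auto
    then have "Fract (C i ?j) (C (i + 1) ?j)
        = Fract (q_int [:0, 1:] (c i i)) 1
          - Fract ([:0, 1:] ^ (c i i - 1)) 1 / Fract (C (i + 1) ?j) (C (i + 2) ?j)"
      using nz1 nz2 by (simp only:) (simp add: eq_fract algebra_simps)
    then have "Fract (C i ?j) (C (i + 1) ?j) = q_rational (x i ?j)"
      unfolding R IH(1) by (simp add: Fract_q_int q_var_def Fract_power)
    \<comment> \<open>Two explicit heads are exposed so that the recursive equation of
      \<open>q_hj_cfrac\<close> applies.\<close>
    moreover have "[i..?j] = i # (i + 1) # [i + 2..?j]" "[i + 1..?j] = (i + 1) # [i + 2..?j]"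
      using Suc by (simp_all add: upto_rec1 add.commute[of 2])
    then have "q_rational (x i ?j) = q_hj_cfrac q_var (map (\<lambda>k. c k k) [i..?j])"
      using R IH(2) by simp
    ultimately show ?thesis ..
  qed
  \<comment> \<open>A zero numerator would make the quotient 0, against positivity of the
    q-rational.\<close>
  moreover have "C i ?j \<noteq> 0"
    using main q_rational_pos[OF x_pos] by (auto simp: fract_collapse)
  ultimately show ?case by blast
qed

theorem proposition2p7:
  fixes n :: nat and c :: "int \<Rightarrow> int \<Rightarrow> nat" and C :: "int \<Rightarrow> int \<Rightarrow> rat poly" and i j :: int
  assumes "n \<ge> 2"
    and "is_frieze n c"
    and "is_q_frieze n c C"
    and "0 \<le> j - i" and "j - i \<le> int n - 2"
  shows "Fract (C i j) (C (i + 1) j) = q_rational (of_nat (c i j) / of_nat (c (i + 1) j)) \<and>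
    q_rational (of_nat (c i j) / of_nat (c (i + 1) j)) = q_hj_cfrac q_var (map (\<lambda>k. c k k) [i..j])"
  using q_frieze_row[OF assms(2,3), of "nat (j - i)" i] assms(4,5) by simp

end
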